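(* For all positive integers $n$, the Boolean-Narayana polynomial $\mathrm{BoNa}_n(u)=\sum_{k=1}^n \mathrm{BoNa}(n,k)u^k$ has real roots only.
   Context: A binary plane tree is a rooted plane tree on unlabeled vertices in which every non-leaf vertex has one or two children, and every child is a left child or a right child, even if it is the only child of its parent. A 0-1-tree is a binary plane tree in which every vertex that has two children is labeled 0 or 1 (no other vertex is labeled). A right edge is an edge connecting a vertex to its right child. For $n\ge 1$, the Boolean-Narayana number $\mathrm{BoNa}(n,k)$ is the number of 0-1-trees on $n$ vertices that have exactly $k-1$ right edges. *)

theory Defs
  imports Complex_Main "HOL-Computational_Algebra.Polynomial"
begin

text \<open>0-1-trees. A term is a nonempty tree and each constructor is a vertex; in particular
  \<open>Leaf\<close> is a vertex without children, not an empty tree. The label (0 or 1) of a vertex with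
  two children is encoded as a Boolean.\<close>

datatype zo_tree =
    Leaf
  | Left_Only zo_tree
  | Right_Only zo_tree
  | Both bool zo_tree zo_tree

primrec num_vertices :: "zo_tree \<Rightarrow> nat" where
  "num_vertices Leaf = 1"
| "num_vertices (Left_Only l) = num_vertices l + 1"
| "num_vertices (Right_Only r) = num_vertices r + 1"
| "num_vertices (Both b l r) = num_vertices l + num_vertices r + 1"

primrec num_right_edges :: "zo_tree \<Rightarrow> nat" where
  "num_right_edges Leaf = 0"
| "num_right_edges (Left_Only l) = num_right_edges l"
| "num_right_edges (Right_Only r) = num_right_edges r + 1"
| "num_right_edges (Both b l r) = num_right_edges l + num_right_edges r + 1"

text \<open>Finiteness guarantees that the \<^const>\<open>card\<close> below is a genuine count.\<close>

lemma finite_num_vertices_le: "finite {t. num_vertices t \<le> n}"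
proof (induction n)
  case 0
  have "{t. num_vertices t \<le> 0} = {}"
  proof -
    have "num_vertices t > 0" for t by (cases t) auto
    then show ?thesis by (auto simp: not_le)
  qed
  then show ?case by (simp only: finite.emptyI)
next
  case (Suc n)
  let ?S = "{t. num_vertices t \<le> n}"
  have "t \<in> {Leaf} \<union> Left_Only ` ?S \<union> Right_Only ` ?S
      \<union> (\<lambda>(b, l, r). Both b l r) ` (UNIV \<times> ?S \<times> ?S)"
    if "num_vertices t \<le> Suc n" for t
    using that by (cases t) (auto simp: image_iff)
  then have "{t. num_vertices t \<le> Suc n} \<subseteq> {Leaf} \<union> Left_Only ` ?S \<union> Right_Only ` ?S
      \<union> (\<lambda>(b, l, r). Both b l r) ` (UNIV \<times> ?S \<times> ?S)"
    by blast
  moreover have "finite ({Leaf} \<union> Left_Only ` ?S \<union> Right_Only ` ?S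
      \<union> (\<lambda>(b, l, r). Both b l r) ` (UNIV \<times> ?S \<times> ?S))"
    using Suc by simp
  ultimately show ?case by (rule finite_subset)
qed

lemma finite_num_vertices_eq: "finite {t. num_vertices t = n}"
  by (rule finite_subset[OF _ finite_num_vertices_le[of n]]) auto

text \<open>The condition ``exactly \<open>k - 1\<close> right edges'' is written without truncated subtraction,
  so that the number is 0 for \<open>k = 0\<close>.\<close>

definition BoNa :: "nat \<Rightarrow> nat \<Rightarrow> nat" where
  "BoNa n k = card {t. num_vertices t = n \<and> num_right_edges t + 1 = k}"

definition BoNa_poly :: "nat \<Rightarrow> real poly" where
  "BoNa_poly n = (\<Sum>k = 1..n. monom (of_nat (BoNa n k)) k)"

definition real_rooted :: "real poly \<Rightarrow> bool" where
  "real_rooted p \<longleftrightarrow> (\<forall>z :: complex. poly (map_poly complex_of_real p) z = 0 \<longrightarrow> z \<in> \<real>)"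

end

theory Submission
  imports Defs "HOL-Computational_Algebra.Formal_Power_Series"
begin

unbundle fps_syntax

text \<open>Splitting a tree at its root shows that the generating function \<open>F\<close> of 0-1-trees, by vertices
  and (with weight \<open>u\<close>) right edges, solves the quadratic \<open>F = z (1 + (1 + u) F + 2 u F\<^sup>2)\<close>. The square
  root \<open>S\<close> of its discriminant \<open>D = (1 - (1 + u) z)\<^sup>2 - 8 u z\<^sup>2\<close> satisfies \<open>2 D S' = D' S\<close>, which is a
  three-term recurrence for the coefficients \<open>g\<^sub>n\<close> of \<open>F\<close>. With \<open>q\<^sup>2 = 1 - 6 u + u\<^sup>2\<close> it expresses
  \<open>g\<^sub>n\<^sub>+\<^sub>2 / (q g\<^sub>n\<^sub>+\<^sub>1)\<close> as a positive multiple of \<open>x = (1 + u) / q\<close> minus a nonnegative multiple of the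
  inverse of \<open>g\<^sub>n\<^sub>+\<^sub>1 / (q g\<^sub>n)\<close>. If \<open>u\<close> is not real then neither is \<open>x\<close>, and the sign of \<open>q\<close> can be
  chosen so that \<open>Im x > 0\<close>; then all these ratios stay in the upper half plane, so no \<open>g\<^sub>n\<close> vanishes.\<close>

text \<open>These are the coefficients \<open>g\<^sub>n\<close> of \<open>F\<close>. The exponent
  lacks the shift by 1 in \<open>BoNa\<close>, so the Boolean-Narayana polynomial is
  \<open>u\<close> times this sum.\<close>

definition right_edge_sum :: "nat \<Rightarrow> 'a::comm_semiring_1 \<Rightarrow> 'a" where
  "right_edge_sum n u = (\<Sum>t | num_vertices t = n. u ^ num_right_edges t)"

lemma num_right_edges_less: "num_right_edges t < num_vertices t"
  by (induction t) auto

lemma num_vertices_neq_0 [simp]: "num_vertices t \<noteq> 0"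
  by (cases t) auto

lemma right_edge_sum_0 [simp]: "right_edge_sum 0 u = 0"
  by (simp add: right_edge_sum_def)

lemma right_edge_sum_1 [simp]: "right_edge_sum (Suc 0) u = 1"
proof -
  have "t = Leaf" if "num_vertices t = Suc 0" for t
    using that by (cases t) auto
  hence "{t. num_vertices t = Suc 0} = {Leaf}"
    by auto
  then show ?thesis
    by (simp add: right_edge_sum_def)
qed

text \<open>A root that is not a leaf has only a left child, only a right child, or both; the factor
  2 counts the labels. The terms \<open>i = 0\<close> and \<open>i = n\<close> vanish because no
  tree is empty.\<close>

lemma right_edge_sum_Suc:
  assumes "n \<ge> 1"
  shows "right_edge_sum (Suc n) u = (1 + u) * right_edge_sum n u
           + 2 * u * (\<Sum>i\<le>n. right_edge_sum i u * right_edge_sum (n - i) u)"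
proof -
  let ?w = "\<lambda>t. u ^ num_right_edges t"
  let ?V = "\<lambda>m. {t. num_vertices t = m}"
  let ?P = "(UNIV :: bool set) \<times> (SIGMA i:{..n}. ?V i \<times> ?V (n - i))"
  let ?B = "\<lambda>(b, i, l, r). Both b l r"
  have decomp: "?V (Suc n) = Left_Only ` ?V n \<union> (Right_Only ` ?V n \<union> ?B ` ?P)"
  proof (intro equalityI subsetI)
    fix t assume "t \<in> ?V (Suc n)"
    then show "t \<in> Left_Only ` ?V n \<union> (Right_Only ` ?V n \<union> ?B ` ?P)"
      using assms by (cases t) (force simp: image_iff)+
  qed auto
  have inj: "inj_on ?B ?P"
    by (auto simp: inj_on_def)
  have fin: "finite ?P"
    by (intro finite_cartesian_product finite_SigmaI) (auto simp: finite_num_vertices_eq)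
  have "sum ?w (?B ` ?P) = (\<Sum>(b, i, l, r)\<in>?P. u * (?w l * ?w r))"
    by (subst sum.reindex[OF inj])
      (auto intro!: sum.cong simp: power_add algebra_simps)
  also have "\<dots> = (\<Sum>b\<in>(UNIV :: bool set). \<Sum>i\<le>n. \<Sum>l\<in>?V i. \<Sum>r\<in>?V (n - i). u * (?w l * ?w r))"
    by (subst sum.cartesian_product[symmetric], subst sum.Sigma[symmetric])
      (auto simp: finite_num_vertices_eq sum.cartesian_product)
  also have "\<dots> = 2 * u * (\<Sum>i\<le>n. right_edge_sum i u * right_edge_sum (n - i) u)"
    unfolding right_edge_sum_def sum_product by (simp add: sum_distrib_left mult.assoc)
  finally have both: "sum ?w (?B ` ?P) = \<dots>" .
  have "sum ?w (?V (Suc n)) = sum ?w (Left_Only ` ?V n) + (sum ?w (Right_Only ` ?V n) + sum ?w (?B ` ?P))"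
    unfolding decomp using fin
    by (subst sum.union_disjoint; (subst sum.union_disjoint)?) (auto simp: finite_num_vertices_eq)
  also have "sum ?w (Left_Only ` ?V n) = right_edge_sum n u"
    by (subst sum.reindex) (auto simp: inj_on_def right_edge_sum_def)
  also have "sum ?w (Right_Only ` ?V n) = u * right_edge_sum n u"
    by (subst sum.reindex) (auto simp: inj_on_def right_edge_sum_def sum_distrib_left)
  finally show ?thesis
    unfolding both by (simp add: right_edge_sum_def algebra_simps)
qed

lemma right_edge_sum_fps_eq:
  fixes u :: "'a::comm_ring_1"
  defines "F \<equiv> Abs_fps (\<lambda>n. right_edge_sum n u)"
  shows "F = fps_X * (1 + fps_const (1 + u) * F + fps_const (2 * u) * F\<^sup>2)"
proof (rule fps_ext)
  fix n
  show "F $ n = (fps_X * (1 + fps_const (1 + u) * F + fps_const (2 * u) * F\<^sup>2)) $ n"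
  proof (cases n)
    case 0
    then show ?thesis by (simp add: F_def)
  next
    case (Suc m)
    have "(F\<^sup>2) $ m = (\<Sum>i\<le>m. right_edge_sum i u * right_edge_sum (m - i) u)"
      by (simp add: F_def power2_eq_square fps_mult_nth atLeast0AtMost)
    with Suc show ?thesis
      by (cases "m = 0") (simp_all add: F_def right_edge_sum_Suc)
  qed
qed

lemma right_edge_sum_recurrence:
  fixes u :: "'a::{idom, ring_char_0}"
  assumes "u \<noteq> 0" "n \<ge> 1"
  shows "of_nat (n + 3) * right_edge_sum (n + 2) u =
           of_nat (2 * n + 3) * (1 + u) * right_edge_sum (n + 1) u
           - of_nat n * (1 - 6 * u + u\<^sup>2) * right_edge_sum n u"
proof -
  define F where "F = Abs_fps (\<lambda>n. right_edge_sum n u)"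
  define U where "U = fps_const u"
  \<comment> \<open>Completing the square in the quadratic for \<open>F\<close> gives this root of
    its discriminant.\<close>
  define S where "S = 1 - (1 + U) * fps_X - 4 * U * fps_X * F"
  define D where "D = 1 - 2 * (1 + U) * fps_X + (1 - 6 * U + U\<^sup>2) * fps_X\<^sup>2"
  have F: "F = fps_X * (1 + (1 + U) * F + 2 * U * F\<^sup>2)"
    using right_edge_sum_fps_eq[of u]
    by (simp add: F_def U_def flip: fps_const_add fps_const_mult fps_numeral_fps_const)
  have sq: "S\<^sup>2 = D"
    unfolding S_def D_def using F by algebra
  have "S \<noteq> 0"
  proof
    assume "S = 0"
    then have "S $ 0 = 0" by simp
    then show False by (simp add: S_def)
  qed
  moreover have "2 * S * fps_deriv S = fps_deriv D"
    using arg_cong[OF sq, of fps_deriv] by (simp add: power2_eq_square algebra_simps)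
  then have "2 * D * fps_deriv S = fps_deriv D * S"
    unfolding sq[symmetric] by (simp add: power2_eq_square algebra_simps)
  then have "2 * (D * fps_deriv S) = 2 * (((1 - 6 * U + U\<^sup>2) * fps_X - (1 + U)) * S)"
    unfolding D_def U_def by (simp add: power2_eq_square algebra_simps fps_deriv_mult)
  then have ode: "D * fps_deriv S = ((1 - 6 * U + U\<^sup>2) * fps_X - (1 + U)) * S"
    by simp
  define a where "a = 1 + u"
  define c where "c = 1 - 6 * u + u\<^sup>2"
  have const_eqs: "1 + U = fps_const a" "1 - 6 * U + U\<^sup>2 = fps_const c"
    by (simp_all add: U_def a_def c_def flip: fps_const_add fps_const_sub fps_const_power fps_const_mult fps_numeral_fps_const)
  have S_nth: "S $ (Suc (Suc k)) = - 4 * u * right_edge_sum (Suc k) u" for k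
    by (simp add: S_def F_def U_def fps_numeral_fps_const mult.assoc)
  obtain m where m: "n = Suc m"
    using \<open>n \<ge> 1\<close> by (cases n) auto
  have "D * fps_deriv S = fps_deriv S - fps_const (2 * a) * (fps_X * fps_deriv S)
      + fps_const c * (fps_X * (fps_X * fps_deriv S))"
    unfolding D_def const_eqs by (simp add: power2_eq_square algebra_simps fps_numeral_fps_const)
  moreover have "((1 - 6 * U + U\<^sup>2) * fps_X - (1 + U)) * S = fps_const c * (fps_X * S) - fps_const a * S"
    unfolding const_eqs by (simp add: algebra_simps)
  \<comment> \<open>Degree \<open>n + 2\<close> involves the coefficients of \<open>S\<close> at
    \<open>n + 1\<close>, \<open>n + 2\<close> and \<open>n + 3\<close>. As
    \<open>n \<ge> 1\<close>, all these indices are at least 2, where \<open>S_nth\<close> applies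
    and the linear part of \<open>S\<close> contributes nothing.\<close>
  ultimately have "(fps_deriv S - fps_const (2 * a) * (fps_X * fps_deriv S)
      + fps_const c * (fps_X * (fps_X * fps_deriv S))) $ (n + 2)
    = (fps_const c * (fps_X * S) - fps_const a * S) $ (n + 2)"
    using ode by simp
  then have "(- 4 * u) * (of_nat (n + 3) * right_edge_sum (n + 2) u) =
      (- 4 * u) * (of_nat (2 * n + 3) * a * right_edge_sum (n + 1) u
        - of_nat n * c * right_edge_sum n u)"
    by (simp add: m S_nth) algebra
  then show ?thesis
    using \<open>u \<noteq> 0\<close> unfolding a_def c_def by simp
qed

text \<open>For \<open>t \<noteq> 1\<close> this is a real quadratic in \<open>u\<close>, namely
  \<open>(1 - t) * u\<^sup>2 + 2 * (1 + 3 * t) * u + (1 - t) = 0\<close>. A quarter of its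
  discriminant is \<open>8 * t * (1 + t) \<ge> 0\<close>.\<close>

lemma real_if_square_ratio_nonneg:
  fixes u :: complex and t :: real
  assumes "t \<ge> 0" and eq: "(1 + u)\<^sup>2 = of_real t * (1 - 6 * u + u\<^sup>2)"
  shows "u \<in> \<real>"
proof (cases "t = 1")
  case True
  then have "8 * u = 0" using eq by (simp add: power2_eq_square algebra_simps)
  then show ?thesis by simp
next
  case False
  define r where "r = sqrt (8 * t * (1 + t))"
  have "(of_real r)\<^sup>2 = (of_real (8 * t * (1 + t)) :: complex)"
    using \<open>t \<ge> 0\<close> by (simp add: r_def flip: of_real_power)
  also have "\<dots> = (of_real (1 - t) * u + of_real (1 + 3 * t))\<^sup>2"
    using eq unfolding of_real_mult of_real_add of_real_diff of_real_1 of_real_numeral by algebra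
  finally have "of_real (1 - t) * u + of_real (1 + 3 * t) = of_real r
      \<or> of_real (1 - t) * u + of_real (1 + 3 * t) = - of_real r"
    by (metis power2_eq_iff)
  then have "of_real (1 - t) * u = of_real (r - (1 + 3 * t)) \<or> of_real (1 - t) * u = of_real (- r - (1 + 3 * t))"
    by (auto simp: algebra_simps)
  then have "of_real (1 - t) * u \<in> \<real>"
    by (metis Reals_of_real)
  moreover have "u = of_real (1 - t) * u / of_real (1 - t)"
    using False by simp
  ultimately show ?thesis
    by (metis Reals_divide Reals_of_real)
qed

lemma right_edge_sum_nonzero:
  fixes u :: complex
  assumes "u \<notin> \<real>" "n \<ge> 1"
  shows "right_edge_sum n u \<noteq> 0"
proof -
  let ?g = "\<lambda>n. right_edge_sum n u"
  define q0 where "q0 = csqrt (1 - 6 * u + u\<^sup>2)"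
  have "u \<noteq> 0"
    using \<open>u \<notin> \<real>\<close> by auto
  have nonreal: "(1 + u) / q0 \<notin> \<real>"
  proof
    assume "(1 + u) / q0 \<in> \<real>"
    then obtain y where y: "(1 + u) / q0 = of_real y"
      by (auto elim: Reals_cases)
    \<comment> \<open>Division by zero yields the real number 0, so this case needs its own
      argument: the roots \<open>3 \<plusminus> sqrt 8\<close> of the radicand are real.\<close>
    have "q0 \<noteq> 0"
    proof
      assume "q0 = 0"
      then have "1 - 6 * u + u\<^sup>2 = 0"
        by (simp add: q0_def)
      then have "(u - 3)\<^sup>2 = (of_real (sqrt 8))\<^sup>2"
        by (simp add: power2_eq_square algebra_simps flip: of_real_mult)
      then have "u - 3 = of_real (sqrt 8) \<or> u - 3 = - of_real (sqrt 8)"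
        by (simp only: power2_eq_iff)
      then have "u = of_real (3 + sqrt 8) \<or> u = of_real (3 - sqrt 8)"
        by (auto simp: algebra_simps)
      then show False
        using \<open>u \<notin> \<real>\<close> by (metis Reals_of_real)
    qed
    then have "1 + u = of_real y * q0"
      using y by (simp add: field_simps)
    then have "(1 + u)\<^sup>2 = of_real (y\<^sup>2) * (1 - 6 * u + u\<^sup>2)"
      by (simp add: power_mult_distrib q0_def)
    then show False
      using real_if_square_ratio_nonneg[of "y\<^sup>2" u] \<open>u \<notin> \<real>\<close> by simp
  qed
  define q where "q = (if Im ((1 + u) / q0) > 0 then q0 else - q0)"
  have q2: "1 - 6 * u + u\<^sup>2 = q\<^sup>2"
    by (simp add: q_def q0_def)
  have x: "Im ((1 + u) / q) > 0"
    using nonreal by (auto simp: q_def complex_is_Real_iff)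
  then have "q \<noteq> 0"
    by auto
  \<comment> \<open>The index starts at 1 because \<open>g\<^sub>0 = 0\<close>. The first ratio is
    \<open>(1 + u) / q\<close> itself.\<close>
  have "?g (Suc n) \<noteq> 0 \<and> Im (?g (Suc (Suc n)) / (q * ?g (Suc n))) > 0" for n
  proof (induction n)
    case 0
    have "?g (Suc (Suc 0)) = 1 + u"
      by (subst right_edge_sum_Suc) (simp_all add: atMost_Suc)
    then show ?case
      using x by simp
  next
    case (Suc n)
    define R where "R = ?g (Suc (Suc n)) / (q * ?g (Suc n))"
    have R: "Im R > 0"
      using Suc by (simp add: R_def)
    \<comment> \<open>A vanishing numerator would make \<open>R = 0\<close>, contradicting
      \<open>Im R > 0\<close>.\<close>
    then have nz: "?g (Suc n) \<noteq> 0" "?g (Suc (Suc n)) \<noteq> 0"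
      using Suc by (auto simp: R_def)
    have "of_nat (n + 4) * ?g (Suc (Suc (Suc n))) =
        of_nat (2 * n + 5) * (1 + u) * ?g (Suc (Suc n)) - of_nat (Suc n) * q\<^sup>2 * ?g (Suc n)"
      using right_edge_sum_recurrence[OF \<open>u \<noteq> 0\<close>, of "Suc n"] q2 by (simp add: numeral_eq_Suc)
    then have "of_nat (n + 4) * ?g (Suc (Suc (Suc n))) / (q * ?g (Suc (Suc n))) =
        of_nat (2 * n + 5) * ((1 + u) / q) - of_nat (Suc n) * inverse R"
      using nz \<open>q \<noteq> 0\<close> unfolding R_def by (simp add: divide_simps power2_eq_square)
    then have eq: "of_real (real (n + 4)) * (?g (Suc (Suc (Suc n))) / (q * ?g (Suc (Suc n)))) =
        of_real (real (2 * n + 5)) * ((1 + u) / q) - of_real (real (Suc n)) * inverse R"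
      by (simp only: of_real_of_nat_eq times_divide_eq_right)
    have Im_scale: "Im (of_real a * z) = a * Im z" for a z
      by simp
    \<comment> \<open>Inversion swaps the upper and lower half planes, so subtracting a positive
      multiple of \<open>inverse R\<close> only raises the imaginary part.\<close>
    have "Im (inverse R) \<le> 0"
      using R by (simp add: divide_nonpos_nonneg)
    then have "real (Suc n) * Im (inverse R) \<le> 0"
      by (intro mult_nonneg_nonpos) auto
    moreover have "real (2 * n + 5) * Im ((1 + u) / q) > 0"
      using x by (intro mult_pos_pos) auto
    ultimately have "real (n + 4) * Im (?g (Suc (Suc (Suc n))) / (q * ?g (Suc (Suc n)))) > 0"
      using arg_cong[OF eq, of Im] unfolding minus_complex.sel Im_scale by linarith
    then show ?case
      using nz by (simp add: zero_less_mult_iff)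
  qed
  from this[of "n - 1"] show ?thesis
    using \<open>n \<ge> 1\<close> by simp
qed

text \<open>Trees are grouped by their number \<open>k - 1\<close> of right edges, which is less
  than \<open>n\<close>; the shift by 1 produces the factor \<open>z\<close>, whose only root 0 is
  real.\<close>

lemma poly_BoNa_poly:
  "poly (map_poly complex_of_real (BoNa_poly n)) z = z * right_edge_sum n z"
proof -
  have "z * right_edge_sum n z = (\<Sum>t | num_vertices t = n. z ^ (num_right_edges t + 1))"
    by (simp add: right_edge_sum_def sum_distrib_left)
  also have "\<dots> = (\<Sum>k = 1..n. \<Sum>t | t \<in> {t. num_vertices t = n} \<and> num_right_edges t + 1 = k. z ^ (num_right_edges t + 1))"
    using num_right_edges_less
    by (intro sum.group[symmetric]) (auto simp: finite_num_vertices_eq Suc_le_eq)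
  also have "\<dots> = (\<Sum>k = 1..n. of_nat (BoNa n k) * z ^ k)"
    unfolding BoNa_def by (intro sum.cong) auto
  also have "\<dots> = poly (map_poly complex_of_real (BoNa_poly n)) z"
  proof -
    have "map_poly complex_of_real (BoNa_poly n) = (\<Sum>k = 1..n. monom (of_nat (BoNa n k)) k)"
      by (rule poly_eqI) (simp add: BoNa_poly_def coeff_map_poly coeff_sum if_distrib cong: if_cong)
    then show ?thesis
      by (simp add: poly_sum poly_monom)
  qed
  finally show ?thesis ..
qed

theorem theorem5p1:
  fixes n :: nat
  assumes "n \<ge> 1"
  shows "real_rooted (BoNa_poly n)"
  unfolding real_rooted_def poly_BoNa_poly
  using assms right_edge_sum_nonzero by (metis Reals_0 mult_eq_0_iff)

end
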